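(* Let $I\subseteq\mathbf{R}$ be an open interval and let $S:I\times\mathbf{R}^2\to su(1,1)$ be a $C^3$ solution of the Schrödinger map equation from $\mathbf{R}^2$ to $\mathbf{H}^2$ in matrix form, $$S_t=-\tfrac12[S,S_{z\bar z}],\qquad S=\begin{pmatrix} is_3 & s_1+is_2\\ s_1-is_2 & -is_3\end{pmatrix},\quad s_1,s_2,s_3 \text{ real},\quad s_1^2+s_2^2-s_3^2=-1,\ s_3<0 .$$ Then there is a matrix-valued function $G:I\times\mathbf{R}^2\to SU(1,1)$ such that $S$ is transformed, by the gauge transformation with $G$ (in the sense defined in the context), to a solution $(p,q,r,u)$, with $p,q,r$ complex-valued and $u$ real-valued functions on $I\times\mathbf{R}^2$, of the system $$\begin{cases} iq_t+q_{z\bar z}-2uq+2(\bar p q)_z-2pq_{\bar z}-4|p|^2q=0,\\ ir_t-r_{z\bar z}+2ur+2(\bar p r)_z-2pr_{\bar z}+4|p|^2r=0,\\ ip_t+(qr)_{\bar z}-u_z=0,\\ \bar p_z+p_{\bar z}=-|q|^2+|r|^2,\\ -\bar r_z+q_{\bar z}=-2(p\bar r+\bar p q).\end{cases}$$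
   Context: Coordinates on $\mathbf{R}^2$ are $(x_1,x_2)$, with $z=\frac{x_1+ix_2}{2}$ and $\bar z=\frac{x_1-ix_2}{2}$ (note the nonstandard factor $\frac12$), so that $\partial_z=\partial_{x_1}-i\partial_{x_2}$, $\partial_{\bar z}=\partial_{x_1}+i\partial_{x_2}$ and $\partial_z\partial_{\bar z}=\partial_{x_1}^2+\partial_{x_2}^2$. Functions of $(t,z,\bar z)$ are just functions of $(t,x_1,x_2)$, and $\bar p_z$, $\bar r_z$ mean $\partial_z(\bar p)$, $\partial_z(\bar r)$. $SU(1,1)$ is the group of matrices $\begin{pmatrix}A&B\\ \bar B&\bar A\end{pmatrix}$ with $A,B\in\mathbf{C}$, $|A|^2-|B|^2=1$, and $su(1,1)$ is its Lie algebra, consisting of the matrices $\begin{pmatrix} ia& w\\ \bar w&-ia\end{pmatrix}$ with $a\in\mathbf{R}$, $w\in\mathbf{C}$. $\sigma_3=\mathrm{diag}(1,-1)$ and $[X,Y]=XY-YX$. Gauge transformation: an $SU(1,1)$-valued function $G$ gauge transforms $S$ to $(p,q,r,u)$ if $$\sigma_3=iG^{-1}SG,\qquad G^{-1}G_z=-\begin{pmatrix} p&q\\ r&-p\end{pmatrix},\qquad G^{-1}G_{\bar z}=\begin{pmatrix}\bar p&-\bar r\\ -\bar q&-\bar p\end{pmatrix},$$ $$G^{-1}G_t=i\begin{pmatrix} u&-q_{\bar z}-2\bar p q\\ r_{\bar z}-2\bar p r&-u\end{pmatrix}.$$ *)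

theory Defs
  imports "HOL-Analysis.Analysis"
begin

section \<open>Classical differentiability of order k on an open set\<close>

text \<open>
  For an open set \<open>U\<close> in a Euclidean space this is the usual class \<open>C\<^sup>k(U)\<close>, jointly in all
  coordinates.
\<close>

primrec Ck_on :: "nat \<Rightarrow> ('a::real_normed_vector \<Rightarrow> 'b::real_normed_vector) \<Rightarrow> 'a set \<Rightarrow> bool" where
  "Ck_on 0 f U \<longleftrightarrow> continuous_on U f"
| "Ck_on (Suc k) f U \<longleftrightarrow>
     (\<forall>y\<in>U. f differentiable (at y)) \<and>
     (\<forall>v. Ck_on k (\<lambda>y. frechet_derivative f (at y) v) U)"


section \<open>Complex 2 by 2 matrices\<close>

definition mat2 :: "complex \<Rightarrow> complex \<Rightarrow> complex \<Rightarrow> complex \<Rightarrow> complex^2^2" where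
  "mat2 a b c d = vector [vector [a, b], vector [c, d]]"

definition cscale :: "complex \<Rightarrow> complex^2^2 \<Rightarrow> complex^2^2"  (infixr "*\<^sub>M" 75) where
  "c *\<^sub>M A = map_matrix (\<lambda>x. c * x) A"

definition commutator :: "complex^2^2 \<Rightarrow> complex^2^2 \<Rightarrow> complex^2^2" where
  "commutator X Y = X ** Y - Y ** X"

definition sigma3 :: "complex^2^2" where
  "sigma3 = mat2 1 0 0 (-1)"

definition SU11 :: "(complex^2^2) set" where
  "SU11 = {mat2 A B (cnj B) (cnj A) | A B. (cmod A)\<^sup>2 - (cmod B)\<^sup>2 = 1}"

definition su11 :: "(complex^2^2) set" where
  "su11 = {mat2 (\<i> * complex_of_real a) w (cnj w) (- \<i> * complex_of_real a) | a w. True}"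


section \<open>Partial derivatives on space-time\<close>

text \<open>A point \<open>(t, x)\<close> of space-time consists of the time \<open>t\<close> and \<open>x = (x\<^sub>1, x\<^sub>2)\<close>.\<close>

type_synonym spacetime = "real \<times> (real^2)"

definition D_t :: "(spacetime \<Rightarrow> 'b::real_normed_vector) \<Rightarrow> spacetime \<Rightarrow> 'b" where
  "D_t f y = frechet_derivative f (at y) (1, 0)"

definition D_x1 :: "(spacetime \<Rightarrow> 'b::real_normed_vector) \<Rightarrow> spacetime \<Rightarrow> 'b" where
  "D_x1 f y = frechet_derivative f (at y) (0, axis 1 1)"

definition D_x2 :: "(spacetime \<Rightarrow> 'b::real_normed_vector) \<Rightarrow> spacetime \<Rightarrow> 'b" where
  "D_x2 f y = frechet_derivative f (at y) (0, axis 2 1)"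

text \<open>
  The complex coordinate is \<open>z = (x\<^sub>1 + \<i> x\<^sub>2) / 2\<close>, so the Wirtinger derivatives do not carry
  the customary factor 1/2.
\<close>

definition D_z :: "(spacetime \<Rightarrow> complex) \<Rightarrow> spacetime \<Rightarrow> complex" where
  "D_z f y = D_x1 f y - \<i> * D_x2 f y"

definition D_zbar :: "(spacetime \<Rightarrow> complex) \<Rightarrow> spacetime \<Rightarrow> complex" where
  "D_zbar f y = D_x1 f y + \<i> * D_x2 f y"

definition MD_z :: "(spacetime \<Rightarrow> complex^2^2) \<Rightarrow> spacetime \<Rightarrow> complex^2^2" where
  "MD_z F y = D_x1 F y - \<i> *\<^sub>M D_x2 F y"

definition MD_zbar :: "(spacetime \<Rightarrow> complex^2^2) \<Rightarrow> spacetime \<Rightarrow> complex^2^2" where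
  "MD_zbar F y = D_x1 F y + \<i> *\<^sub>M D_x2 F y"


section \<open>The gauge transformation and the gauged system\<close>

text \<open>
  The first line collects the smoothness that makes every derivative below a classical one.
\<close>

definition gauge_transforms ::
  "spacetime set \<Rightarrow> (spacetime \<Rightarrow> complex^2^2) \<Rightarrow> (spacetime \<Rightarrow> complex^2^2) \<Rightarrow>
   (spacetime \<Rightarrow> complex) \<Rightarrow> (spacetime \<Rightarrow> complex) \<Rightarrow> (spacetime \<Rightarrow> complex) \<Rightarrow>
   (spacetime \<Rightarrow> real) \<Rightarrow> bool" where
  "gauge_transforms U G S p q r u \<longleftrightarrow>
     Ck_on 1 G U \<and> Ck_on 1 q U \<and> Ck_on 1 r U \<and>
     (\<forall>y\<in>U.
        G y \<in> SU11 \<and>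
        sigma3 = \<i> *\<^sub>M (matrix_inv (G y) ** S y ** G y) \<and>
        matrix_inv (G y) ** MD_z G y = - mat2 (p y) (q y) (r y) (- p y) \<and>
        matrix_inv (G y) ** MD_zbar G y =
          mat2 (cnj (p y)) (- cnj (r y)) (- cnj (q y)) (- cnj (p y)) \<and>
        matrix_inv (G y) ** D_t G y =
          \<i> *\<^sub>M mat2 (complex_of_real (u y)) (- D_zbar q y - 2 * cnj (p y) * q y)
                   (D_zbar r y - 2 * cnj (p y) * r y) (- complex_of_real (u y)))"

text \<open>
  Classical solutions: \<open>q\<close> and \<open>r\<close>, which enter with second order derivatives, are \<open>C\<^sup>2\<close>;
  \<open>p\<close> and \<open>u\<close> are \<open>C\<^sup>1\<close>.
\<close>

definition gauged_system_solution ::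
  "spacetime set \<Rightarrow> (spacetime \<Rightarrow> complex) \<Rightarrow> (spacetime \<Rightarrow> complex) \<Rightarrow>
   (spacetime \<Rightarrow> complex) \<Rightarrow> (spacetime \<Rightarrow> real) \<Rightarrow> bool" where
  "gauged_system_solution U p q r u \<longleftrightarrow>
     Ck_on 1 p U \<and> Ck_on 2 q U \<and> Ck_on 2 r U \<and> Ck_on 1 u U \<and>
     (\<forall>y\<in>U.
        \<i> * D_t q y + D_zbar (D_z q) y - 2 * complex_of_real (u y) * q y
          + 2 * D_z (\<lambda>x. cnj (p x) * q x) y - 2 * p y * D_zbar q y
          - 4 * complex_of_real ((cmod (p y))\<^sup>2) * q y = 0 \<and>
        \<i> * D_t r y - D_zbar (D_z r) y + 2 * complex_of_real (u y) * r y
          + 2 * D_z (\<lambda>x. cnj (p x) * r x) y - 2 * p y * D_zbar r y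
          + 4 * complex_of_real ((cmod (p y))\<^sup>2) * r y = 0 \<and>
        \<i> * D_t p y + D_zbar (\<lambda>x. q x * r x) y - D_z (\<lambda>x. complex_of_real (u x)) y = 0 \<and>
        D_z (\<lambda>x. cnj (p x)) y + D_zbar p y =
          - complex_of_real ((cmod (q y))\<^sup>2) + complex_of_real ((cmod (r y))\<^sup>2) \<and>
        - D_z (\<lambda>x. cnj (r x)) y + D_zbar q y =
          - 2 * (p y * cnj (r y) + cnj (p y) * q y))"

end

(*
  No choice of gauge is needed. The condition sigma3 = i G^(-1) S G says that the entries A, B of G
  satisfy s3 = -(|A|^2 + |B|^2) and s1 + i s2 = 2 i A B, and since s3 < 0 it has the explicit solution
  A = sqrt((1 - s3) / 2), B = -i (s1 + i s2) / (2 A), as smooth as S. The form of G^(-1) G_z and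
  G^(-1) G_zbar only expresses that G^(-1) dG takes values in su(1,1). Writing G^(-1) d_v G with
  diagonal entry alpha_v and off-diagonal entry beta_v, the Schroedinger map equation becomes
  beta_t = i (sum_j d_j beta_j + 2 alpha_j beta_j), and all five equations of the gauged system are
  components of the zero curvature equations, that is, of the symmetry of the second derivatives of G.
*)

theory Submission
  imports Defs
begin

section \<open>Calculus of functions of class \<open>C\<^sup>k\<close>\<close>

text \<open>\<open>S\<close> determines its lift \<open>G\<close> only up to right multiplication by
  diagonal phases diag(e^(i theta), e^(-i theta)). Taking \<open>A\<close> positive selects one
  lift, and it is global because |A|^2 = (1 - s3) / 2 exceeds 1/2 on the sheet s3 < 0. The fields
  depend on this selection; the derivation of the system does not, so it is done for every C^3 lift.
  The second row of an SU(1,1) matrix consists of the conjugates of the first, in reversed order.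
  Hence all computations run on two scalar functions, and matrices return only in the translation to
  the stated form. Curvature in the (x1, x2) plane gives the last two equations; it also turns the
  covariant divergence in the formula for beta_t into the entry prescribed for G^(-1) G_t. Curvature
  between time and space gives the three evolution equations, once beta_t is eliminated. The order
  three is spent thus: \<open>G\<close> is C^3, its connection is C^2, and C^2 is what is asked of
  \<open>q\<close> and \<open>r\<close>.\<close>

definition dderiv :: "'a \<Rightarrow> ('a::real_normed_vector \<Rightarrow> 'b::real_normed_vector) \<Rightarrow> 'a \<Rightarrow> 'b" where
  "dderiv v f y = frechet_derivative f (at y) v"

lemma dderiv_eqI: "(f has_derivative f') (at y) \<Longrightarrow> dderiv v f y = f' v"
  unfolding dderiv_def by (metis frechet_derivative_at)

lemma has_derivative_dderiv:
  "f differentiable (at y) \<Longrightarrow> (f has_derivative (\<lambda>v. dderiv v f y)) (at y)"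
  unfolding dderiv_def by (simp add: frechet_derivative_works)

text \<open>\<open>frechet_derivative\<close> is a choice among the derivatives at \<open>y\<close>,
  and functions that agree near \<open>y\<close> have the same ones; so the chosen values agree even
  where no derivative exists.\<close>

lemma dderiv_cong:
  assumes "open U" "y \<in> U" "\<And>x. x \<in> U \<Longrightarrow> f x = g x"
  shows "dderiv v f y = dderiv v g y"
proof -
  have "(f has_derivative D) (at y) \<longleftrightarrow> (g has_derivative D) (at y)" for D
    using assms by (metis has_derivative_transform_within_open)
  then show ?thesis by (simp add: dderiv_def frechet_derivative_def)
qed

lemma differentiable_cong_open:
  assumes "open U" "y \<in> U" "\<And>x. x \<in> U \<Longrightarrow> f x = g x"
  shows "f differentiable (at y) \<longleftrightarrow> g differentiable (at y)"
  using assms unfolding differentiable_def by (metis has_derivative_transform_within_open)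

lemma dderiv_bounded_linear:
  assumes "bounded_linear L" "f differentiable (at y)"
  shows "dderiv v (\<lambda>x. L (f x)) y = L (dderiv v f y)"
  by (rule dderiv_eqI[OF bounded_linear.has_derivative[OF assms(1) has_derivative_dderiv[OF assms(2)]]])

lemma differentiable_bounded_linear:
  assumes "bounded_linear L" "f differentiable (at y)"
  shows "(\<lambda>x. L (f x)) differentiable (at y)"
  using bounded_linear.has_derivative[OF assms(1) has_derivative_dderiv[OF assms(2)]]
  unfolding differentiable_def by blast

lemma dderiv_const [simp]: "dderiv v (\<lambda>x. c) y = 0"
  by (simp add: dderiv_def)

lemma dderiv_add:
  assumes "f differentiable (at y)" "g differentiable (at y)"
  shows "dderiv v (\<lambda>x. f x + g x) y = dderiv v f y + dderiv v g y"
  by (rule dderiv_eqI[OF has_derivative_add[OF assms[THEN has_derivative_dderiv]]])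

lemma dderiv_diff:
  assumes "f differentiable (at y)" "g differentiable (at y)"
  shows "dderiv v (\<lambda>x. f x - g x) y = dderiv v f y - dderiv v g y"
  by (rule dderiv_eqI[OF has_derivative_diff[OF assms[THEN has_derivative_dderiv]]])

lemma dderiv_minus:
  assumes "f differentiable (at y)"
  shows "dderiv v (\<lambda>x. - f x) y = - dderiv v f y"
  by (rule dderiv_eqI[OF has_derivative_minus[OF has_derivative_dderiv[OF assms]]])

lemma dderiv_mult:
  fixes f g :: "'a::real_normed_vector \<Rightarrow> 'b::real_normed_algebra"
  assumes "f differentiable (at y)" "g differentiable (at y)"
  shows "dderiv v (\<lambda>x. f x * g x) y = f y * dderiv v g y + dderiv v f y * g y"
  by (rule dderiv_eqI[OF has_derivative_mult[OF assms[THEN has_derivative_dderiv]]])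

lemma dderiv_cmult:
  fixes f :: "'a::real_normed_vector \<Rightarrow> 'b::real_normed_algebra"
  assumes "f differentiable (at y)"
  shows "dderiv v (\<lambda>x. c * f x) y = c * dderiv v f y"
  by (rule dderiv_bounded_linear[OF bounded_linear_mult_right assms])

lemma dderiv_cnj:
  assumes "f differentiable (at y)"
  shows "dderiv v (\<lambda>x. cnj (f x)) y = cnj (dderiv v f y)"
  by (rule dderiv_bounded_linear[OF bounded_linear_cnj assms])

lemma differentiable_cnj:
  assumes "f differentiable (at y)"
  shows "(\<lambda>x. cnj (f x)) differentiable (at y)"
  by (rule differentiable_bounded_linear[OF bounded_linear_cnj assms])

lemmas dderiv_simps = dderiv_add dderiv_diff dderiv_minus dderiv_cmult dderiv_mult dderiv_cnj

section \<open>Closure properties of the classes C^k\<close>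

lemma Ck_on_Suc:
  "Ck_on (Suc k) f U \<longleftrightarrow> (\<forall>y\<in>U. f differentiable (at y)) \<and> (\<forall>v. Ck_on k (dderiv v f) U)"
  by (simp add: dderiv_def[abs_def])

lemma Ck_on_differentiable: "Ck_on (Suc k) f U \<Longrightarrow> y \<in> U \<Longrightarrow> f differentiable (at y)"
  by simp

lemma Ck_on_dderiv: "Ck_on (Suc k) f U \<Longrightarrow> Ck_on k (dderiv v f) U"
  by (simp only: Ck_on_Suc)

lemma Ck_on_SucD: "Ck_on (Suc k) f U \<Longrightarrow> Ck_on k f U"
proof (induction k arbitrary: f)
  case 0
  then show ?case
    by (auto intro!: continuous_at_imp_continuous_on differentiable_imp_continuous_within)
next
  case (Suc k)
  then show ?case unfolding Ck_on_Suc[of "Suc k"] by (subst Ck_on_Suc) blast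
qed

lemma Ck_on_mono: "Ck_on m f U \<Longrightarrow> k \<le> m \<Longrightarrow> Ck_on k f U"
proof (induction m)
  case (Suc m)
  then show ?case by (metis Ck_on_SucD le_Suc_eq)
qed simp

lemma Ck_on_cong:
  assumes "open U" "\<And>x. x \<in> U \<Longrightarrow> f x = g x"
  shows "Ck_on k f U \<longleftrightarrow> Ck_on k g U"
  using assms(2)
proof (induction k arbitrary: f g)
  case 0
  then show ?case by (simp cong: continuous_on_cong)
next
  case (Suc k)
  have "Ck_on k (dderiv v f) U \<longleftrightarrow> Ck_on k (dderiv v g) U" for v
    by (rule Suc.IH) (rule dderiv_cong[OF assms(1) _ Suc.prems])
  moreover have "f differentiable (at y) \<longleftrightarrow> g differentiable (at y)" if "y \<in> U" for y
    by (rule differentiable_cong_open[OF assms(1) that Suc.prems])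
  ultimately show ?case unfolding Ck_on_Suc by blast
qed

text \<open>The derivative of \<open>L\<close> after \<open>f\<close> is \<open>L\<close> after a
  derivative of \<open>f\<close>, so the induction ranges over all \<open>f\<close>. The scheme
  recurs below: a formula for the derivative, valid on \<open>U\<close>, is shown to be C^k and
  transferred by \<open>Ck_on_cong\<close>.\<close>

lemma Ck_on_bounded_linear:
  assumes "open U" "bounded_linear L" "Ck_on k f U"
  shows "Ck_on k (\<lambda>x. L (f x)) U"
  using assms(3)
proof (induction k arbitrary: f)
  case 0
  then show ?case by (simp add: bounded_linear.continuous_on[OF assms(2)])
next
  case (Suc k)
  have "Ck_on k (dderiv v (\<lambda>x. L (f x))) U" for v
    using Suc.IH[OF Ck_on_dderiv[OF Suc.prems]]
    by (rule Ck_on_cong[OF assms(1), THEN iffD1, rotated])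
      (simp add: dderiv_bounded_linear[OF assms(2) Ck_on_differentiable[OF Suc.prems]])
  then show ?case
    unfolding Ck_on_Suc
    using differentiable_bounded_linear[OF assms(2) Ck_on_differentiable[OF Suc.prems]] by blast
qed

lemma Ck_on_const: "Ck_on k (\<lambda>x. c) U"
proof (induction k arbitrary: c)
  case (Suc k)
  have "dderiv v (\<lambda>x::'a. c) = (\<lambda>x. 0)" for v by auto
  then show ?case unfolding Ck_on_Suc by (simp add: Suc)
qed auto

lemma Ck_on_add:
  assumes "open U" "Ck_on k f U" "Ck_on k g U"
  shows "Ck_on k (\<lambda>x. f x + g x) U"
  using assms(2,3)
proof (induction k arbitrary: f g)
  case 0
  then show ?case by (simp add: continuous_on_add)
next
  case (Suc k)
  note d = Ck_on_differentiable[OF Suc.prems(1)] Ck_on_differentiable[OF Suc.prems(2)]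
  have "Ck_on k (dderiv v (\<lambda>x. f x + g x)) U" for v
    using Suc.IH[OF Suc.prems[THEN Ck_on_dderiv]]
    by (rule Ck_on_cong[OF assms(1), THEN iffD1, rotated]) (simp add: dderiv_add d)
  then show ?case unfolding Ck_on_Suc using d by auto
qed

lemma Ck_on_minus: "open U \<Longrightarrow> Ck_on k f U \<Longrightarrow> Ck_on k (\<lambda>x. - f x) U"
  by (rule Ck_on_bounded_linear[OF _ bounded_linear_minus[OF bounded_linear_ident]])

lemma Ck_on_diff:
  assumes "open U" "Ck_on k f U" "Ck_on k g U"
  shows "Ck_on k (\<lambda>x. f x - g x) U"
  using Ck_on_add[OF assms(1,2) Ck_on_minus[OF assms(1,3)]] by simp

lemma Ck_on_mult:
  fixes f g :: "'a::real_normed_vector \<Rightarrow> 'b::real_normed_algebra"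
  assumes "open U" "Ck_on k f U" "Ck_on k g U"
  shows "Ck_on k (\<lambda>x. f x * g x) U"
  using assms(2,3)
proof (induction k arbitrary: f g)
  case 0
  then show ?case by (simp add: continuous_on_mult)
next
  case (Suc k)
  note d = Ck_on_differentiable[OF Suc.prems(1)] Ck_on_differentiable[OF Suc.prems(2)]
  have "Ck_on k (\<lambda>x. f x * dderiv v g x + dderiv v f x * g x) U" for v
    by (intro Ck_on_add Suc.IH assms(1) Suc.prems[THEN Ck_on_dderiv] Suc.prems[THEN Ck_on_SucD])
  then have "Ck_on k (dderiv v (\<lambda>x. f x * g x)) U" for v
    by (rule Ck_on_cong[OF assms(1), THEN iffD1, rotated, of _ "\<lambda>x. f x * dderiv v g x + dderiv v f x * g x"])
      (simp add: dderiv_mult d)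
  then show ?case unfolding Ck_on_Suc using d by auto
qed

lemma Ck_on_cmult:
  fixes f :: "'a::real_normed_vector \<Rightarrow> 'b::real_normed_algebra"
  shows "open U \<Longrightarrow> Ck_on k f U \<Longrightarrow> Ck_on k (\<lambda>x. c * f x) U"
  by (rule Ck_on_mult[OF _ Ck_on_const])

lemma Ck_on_cnj: "open U \<Longrightarrow> Ck_on k f U \<Longrightarrow> Ck_on k (\<lambda>x. cnj (f x)) U"
  by (rule Ck_on_bounded_linear[OF _ bounded_linear_cnj])

lemmas Ck_on_intros = Ck_on_const Ck_on_add Ck_on_minus Ck_on_diff Ck_on_mult Ck_on_cnj

text \<open>The derivative of 1/f is built from f' and 1/f itself, so the induction hypothesis is
  applied to the same \<open>f\<close>, one order lower. \<open>Ck_on_sqrt\<close> works alike, with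
  derivative f' / (2 sqrt f).\<close>

lemma Ck_on_inverse:
  fixes f :: "'a::real_normed_vector \<Rightarrow> 'b::real_normed_div_algebra"
  assumes "open U" "Ck_on k f U" "\<And>x. x \<in> U \<Longrightarrow> f x \<noteq> 0"
  shows "Ck_on k (\<lambda>x. inverse (f x)) U"
  using assms(2,3)
proof (induction k)
  case 0
  then show ?case by (simp add: continuous_on_inverse)
next
  case (Suc k)
  have D: "((\<lambda>x. inverse (f x)) has_derivative
      (\<lambda>v. - (inverse (f y) * dderiv v f y * inverse (f y)))) (at y)" if "y \<in> U" for y
    by (rule Deriv.has_derivative_inverse)
      (use that Suc.prems in \<open>auto intro!: has_derivative_dderiv\<close>)
  have "Ck_on k (\<lambda>y. - (inverse (f y) * dderiv v f y * inverse (f y))) U" for v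
    by (intro Ck_on_minus Ck_on_mult Suc.IH assms(1) Ck_on_dderiv[OF Suc.prems(1)]
        Ck_on_SucD[OF Suc.prems(1)] Suc.prems(2))
  then have "Ck_on k (dderiv v (\<lambda>x. inverse (f x))) U" for v
    by (rule Ck_on_cong[OF assms(1), THEN iffD1, rotated, of _ "\<lambda>y. - (inverse (f y) * dderiv v f y * inverse (f y))"]) (simp add: dderiv_eqI[OF D])
  then show ?case unfolding Ck_on_Suc using D by (auto simp: differentiable_def)
qed

lemma Ck_on_sqrt:
  fixes f :: "'a::real_normed_vector \<Rightarrow> real"
  assumes "open U" "Ck_on k f U" "\<And>x. x \<in> U \<Longrightarrow> f x > 0"
  shows "Ck_on k (\<lambda>x. sqrt (f x)) U"
  using assms(2,3)
proof (induction k)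
  case 0
  then show ?case by (simp add: continuous_on_real_sqrt)
next
  case (Suc k)
  have D: "((\<lambda>x. sqrt (f x)) has_derivative
      (\<lambda>v. inverse (2 * sqrt (f y)) * dderiv v f y)) (at y)" if "y \<in> U" for y
  proof -
    have "(f has_derivative (\<lambda>v. dderiv v f y)) (at y)"
      using that Suc.prems by (auto intro!: has_derivative_dderiv)
    from has_derivative_real_sqrt[OF _ this] Suc.prems(2)[OF that]
    show ?thesis by (simp add: field_simps)
  qed
  have "Ck_on k (\<lambda>y. inverse (2 * sqrt (f y)) * dderiv v f y) U" for v
    by (intro Ck_on_inverse Ck_on_mult Ck_on_const Suc.IH assms(1) Ck_on_dderiv[OF Suc.prems(1)]
        Ck_on_SucD[OF Suc.prems(1)] Suc.prems(2)) (use Suc.prems(2) in force)+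
  then have "Ck_on k (dderiv v (\<lambda>x. sqrt (f x))) U" for v
    by (rule Ck_on_cong[OF assms(1), THEN iffD1, rotated, of _ "\<lambda>y. inverse (2 * sqrt (f y)) * dderiv v f y"]) (simp add: dderiv_eqI[OF D])
  then show ?case unfolding Ck_on_Suc using D by (auto simp: differentiable_def)
qed

section \<open>Symmetry of second derivatives\<close>

lemma second_difference_mean_value:
  fixes f :: "'a::real_normed_vector \<Rightarrow> real"
  assumes "Ck_on 2 f U" "h > 0"
    and U: "\<And>s t. s \<in> {0..h} \<Longrightarrow> t \<in> {0..h} \<Longrightarrow> y + s *\<^sub>R v + t *\<^sub>R w \<in> U"
  shows "\<exists>s\<in>{0..h}. \<exists>t\<in>{0..h}.
    f (y + h *\<^sub>R v + h *\<^sub>R w) - f (y + h *\<^sub>R v) - f (y + h *\<^sub>R w) + f y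
      = h\<^sup>2 * dderiv w (dderiv v f) (y + s *\<^sub>R v + t *\<^sub>R w)"
proof -
  have along: "((\<lambda>s. g (x + s *\<^sub>R d)) has_derivative (\<lambda>s. s * dderiv d g (x + s0 *\<^sub>R d))) (at s0 within X)"
    if "g differentiable (at (x + s0 *\<^sub>R d))" for g :: "'a \<Rightarrow> real" and x d s0 X
  proof -
    have "((\<lambda>s. x + s *\<^sub>R d) has_derivative (\<lambda>s. s *\<^sub>R d)) (at s0 within X)"
      by (auto intro!: derivative_eq_intros)
    from has_derivative_compose[OF this has_derivative_dderiv[OF that]]
    have "((\<lambda>s. g (x + s *\<^sub>R d)) has_derivative (\<lambda>s. dderiv (s *\<^sub>R d) g (x + s0 *\<^sub>R d))) (at s0 within X)" .
    moreover have "dderiv (s *\<^sub>R d) g (x + s0 *\<^sub>R d) = s * dderiv d g (x + s0 *\<^sub>R d)" for s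
      using linear_frechet_derivative[OF that] by (simp add: dderiv_def linear_cmul)
    ultimately show ?thesis by simp
  qed
  have C2: "Ck_on (Suc (Suc 0)) f U" using assms(1) by (simp add: numeral_2_eq_2)
  \<comment> \<open>The second difference is \<open>\<phi> h - \<phi> 0\<close>. The mean value
    theorem in direction \<open>v\<close> brings out \<open>dderiv v f\<close>, a second one in
    direction \<open>w\<close> the mixed derivative.\<close>
  define \<phi> where "\<phi> s = f (y + h *\<^sub>R w + s *\<^sub>R v) - f (y + s *\<^sub>R v)" for s
  have "(\<phi> has_derivative (\<lambda>d. d * dderiv v f (y + h *\<^sub>R w + s *\<^sub>R v) - d * dderiv v f (y + s *\<^sub>R v)))
      (at s within {0..h})" if "0 \<le> s" "s \<le> h" for s
    unfolding \<phi>_def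
    by (intro has_derivative_diff along Ck_on_differentiable[OF C2])
      (use U[of s h] U[of s 0] that \<open>h > 0\<close> in \<open>auto simp: algebra_simps\<close>)
  from mvt_simple[OF \<open>h > 0\<close> this] obtain s where s: "s \<in> {0<..<h}" and
    1: "\<phi> h - \<phi> 0 = h * (dderiv v f (y + s *\<^sub>R v + h *\<^sub>R w) - dderiv v f (y + s *\<^sub>R v))"
    by (auto simp: algebra_simps)
  have "((\<lambda>t. dderiv v f (y + s *\<^sub>R v + t *\<^sub>R w)) has_derivative
      (\<lambda>d. d * dderiv w (dderiv v f) (y + s *\<^sub>R v + t *\<^sub>R w))) (at t within {0..h})"
    if "0 \<le> t" "t \<le> h" for t
    by (intro along Ck_on_differentiable[OF Ck_on_dderiv[OF C2]])
      (use U[of s t] that s in auto)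
  from mvt_simple[OF \<open>h > 0\<close> this] obtain t where t: "t \<in> {0<..<h}" and
    2: "dderiv v f (y + s *\<^sub>R v + h *\<^sub>R w) - dderiv v f (y + s *\<^sub>R v)
      = h * dderiv w (dderiv v f) (y + s *\<^sub>R v + t *\<^sub>R w)"
    by auto
  have "\<phi> h - \<phi> 0 = h\<^sup>2 * dderiv w (dderiv v f) (y + s *\<^sub>R v + t *\<^sub>R w)"
    using 1 2 by (simp add: power2_eq_square)
  then show ?thesis
    using s t by (intro bexI[of _ s] bexI[of _ t]) (auto simp: \<phi>_def algebra_simps)
qed

text \<open>The second difference over a parallelogram is symmetric in \<open>v\<close> and
  \<open>w\<close>. Hence the two mixed derivatives share a value, attained at two possibly
  different points near \<open>y\<close>, and continuity carries the equality to
  \<open>y\<close>.\<close>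

lemma dderiv_commute_real:
  fixes f :: "'a::real_normed_vector \<Rightarrow> real"
  assumes "open U" "Ck_on 2 f U" "y \<in> U"
  shows "dderiv v (dderiv w f) y = dderiv w (dderiv v f) y"
proof -
  have C: "continuous_on U (dderiv a (dderiv b f))" for a b
    using assms(2) unfolding numeral_2_eq_2 Ck_on_Suc by simp
  show ?thesis
  proof (rule ccontr)
    \<comment> \<open>Half the gap, so that two errors below \<open>e\<close> cannot bridge
      it.\<close>
    define e where "e = dist (dderiv v (dderiv w f) y) (dderiv w (dderiv v f) y) / 2"
    assume "dderiv v (dderiv w f) y \<noteq> dderiv w (dderiv v f) y"
    then have "e > 0" by (simp add: e_def)
    obtain d0 where d0: "d0 > 0" "ball y d0 \<subseteq> U" using assms(1,3) openE by blast
    have "\<exists>d>0. \<forall>x. dist x y < d \<longrightarrow> dist (dderiv a (dderiv b f) x) (dderiv a (dderiv b f) y) < e" for a b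
      using C[of a b] assms(1,3) \<open>e > 0\<close>
      by (metis continuous_on_eq_continuous_at continuous_at_eps_delta dist_norm)
    then obtain d1 d2 where d1: "d1 > 0"
        "\<And>x. dist x y < d1 \<Longrightarrow> dist (dderiv v (dderiv w f) x) (dderiv v (dderiv w f) y) < e"
      and d2: "d2 > 0"
        "\<And>x. dist x y < d2 \<Longrightarrow> dist (dderiv w (dderiv v f) x) (dderiv w (dderiv v f) y) < e"
      by metis
    define d where "d = min d0 (min d1 d2)"
    \<comment> \<open>The summand 1 keeps \<open>M\<close> positive when \<open>v\<close> and
      \<open>w\<close> vanish; the 2 in \<open>h\<close> keeps the parallelogram within d / 2 of
      \<open>y\<close>.\<close>
    define M where "M = 1 + norm v + norm w"
    define h where "h = d / (2 * M)"
    have "d > 0" using d0 d1 d2 by (simp add: d_def)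
    have "M > 0" unfolding M_def by (smt (verit) norm_ge_zero)
    have "h > 0" using \<open>d > 0\<close> \<open>M > 0\<close> by (simp add: h_def)
    have near: "dist (y + s *\<^sub>R v + t *\<^sub>R w) y < d" if "s \<in> {0..h}" "t \<in> {0..h}" for s t
    proof -
      have "dist (y + s *\<^sub>R v + t *\<^sub>R w) y = norm (s *\<^sub>R v + t *\<^sub>R w)"
        by (simp add: dist_norm algebra_simps)
      also have "\<dots> \<le> norm (s *\<^sub>R v) + norm (t *\<^sub>R w)" by (rule norm_triangle_ineq)
      also have "\<dots> \<le> h * norm v + h * norm w"
        using that by (intro add_mono) (auto intro!: mult_right_mono)
      also have "\<dots> \<le> h * M" using \<open>h > 0\<close> by (simp add: M_def algebra_simps)
      also have "\<dots> = d / 2" using \<open>M > 0\<close> by (simp add: h_def)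
      also have "\<dots> < d" using \<open>d > 0\<close> by simp
      finally show ?thesis .
    qed
    have inU: "y + s *\<^sub>R v + t *\<^sub>R w \<in> U" if "s \<in> {0..h}" "t \<in> {0..h}" for s t
      using near[OF that] d0 by (auto simp: d_def dist_commute subset_iff)
    have inU': "y + s *\<^sub>R w + t *\<^sub>R v \<in> U" if "s \<in> {0..h}" "t \<in> {0..h}" for s t
      using inU[OF that(2,1)] by (simp add: algebra_simps)
    obtain s t where st: "s \<in> {0..h}" "t \<in> {0..h}"
      and 1: "f (y + h *\<^sub>R v + h *\<^sub>R w) - f (y + h *\<^sub>R v) - f (y + h *\<^sub>R w) + f y
      = h\<^sup>2 * dderiv w (dderiv v f) (y + s *\<^sub>R v + t *\<^sub>R w)"
      using second_difference_mean_value[OF assms(2) \<open>h > 0\<close> inU] by blast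
    obtain s' t' where st': "s' \<in> {0..h}" "t' \<in> {0..h}"
      and 2: "f (y + h *\<^sub>R w + h *\<^sub>R v) - f (y + h *\<^sub>R w) - f (y + h *\<^sub>R v) + f y
      = h\<^sup>2 * dderiv v (dderiv w f) (y + s' *\<^sub>R w + t' *\<^sub>R v)"
      using second_difference_mean_value[OF assms(2) \<open>h > 0\<close> inU'] by blast
    have "h\<^sup>2 * dderiv w (dderiv v f) (y + s *\<^sub>R v + t *\<^sub>R w)
        = h\<^sup>2 * dderiv v (dderiv w f) (y + t' *\<^sub>R v + s' *\<^sub>R w)"
      using 1 2 by (simp add: algebra_simps)
    then have "dderiv w (dderiv v f) (y + s *\<^sub>R v + t *\<^sub>R w)
        = dderiv v (dderiv w f) (y + t' *\<^sub>R v + s' *\<^sub>R w)"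
      using \<open>h > 0\<close> by simp
    moreover have "dist (dderiv w (dderiv v f) (y + s *\<^sub>R v + t *\<^sub>R w)) (dderiv w (dderiv v f) y) < e"
      using near[OF st] by (intro d2) (simp add: d_def)
    moreover have "dist (dderiv v (dderiv w f) (y + t' *\<^sub>R v + s' *\<^sub>R w)) (dderiv v (dderiv w f) y) < e"
      using near[OF st'(2,1)] by (intro d1) (simp add: d_def)
    ultimately show False unfolding e_def dist_real_def by argo
  qed
qed

text \<open>The mean value argument is for real values; inner products with basis vectors reduce to
  it.\<close>

lemma dderiv_commute:
  fixes f :: "'a::real_normed_vector \<Rightarrow> 'b::euclidean_space"
  assumes "open U" "Ck_on 2 f U" "y \<in> U"
  shows "dderiv v (dderiv w f) y = dderiv w (dderiv v f) y"
proof (rule euclidean_eqI)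
  fix b :: 'b
  have C2: "Ck_on (Suc (Suc 0)) f U" using assms(2) by (simp add: numeral_2_eq_2)
  note d = Ck_on_differentiable[OF C2] Ck_on_differentiable[OF Ck_on_dderiv[OF C2]]
  have L: "bounded_linear (\<lambda>x::'b. x \<bullet> b)" by (rule bounded_linear_inner_left)
  have swap: "dderiv v (dderiv w f) y \<bullet> b = dderiv v (dderiv w (\<lambda>x. f x \<bullet> b)) y" for v w
  proof -
    have "dderiv v (dderiv w f) y \<bullet> b = dderiv v (\<lambda>x. dderiv w f x \<bullet> b) y"
      by (rule dderiv_bounded_linear[OF L d(2)[OF assms(3)], symmetric])
    also have "\<dots> = dderiv v (dderiv w (\<lambda>x. f x \<bullet> b)) y"
      by (rule dderiv_cong[OF assms(1,3)]) (rule dderiv_bounded_linear[OF L d(1), symmetric])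
    finally show ?thesis .
  qed
  show "dderiv v (dderiv w f) y \<bullet> b = dderiv w (dderiv v f) y \<bullet> b"
    unfolding swap
    by (rule dderiv_commute_real[OF assms(1) Ck_on_bounded_linear[OF assms(1) L assms(2)] assms(3)])
qed

section \<open>Zero curvature of an \<open>SU(1,1)\<close>-valued function\<close>

text \<open>\<open>A\<close> and \<open>B\<close> are the first row of \<open>G\<close>, and
  \<open>det\<close> says det G = 1. Directions are arbitrary vectors, so time and space enter the
  curvature equations alike.\<close>

locale su_frame =
  fixes U :: "'a::real_normed_vector set" and A B :: "'a \<Rightarrow> complex"
  assumes open_U: "open U"
    and A3: "Ck_on 3 A U" and B3: "Ck_on 3 B U"
    and det: "\<And>y. y \<in> U \<Longrightarrow> A y * cnj (A y) - B y * cnj (B y) = 1"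
begin

definition \<alpha> :: "'a \<Rightarrow> 'a \<Rightarrow> complex" where
  "\<alpha> v y = cnj (A y) * dderiv v A y - B y * cnj (dderiv v B y)"

definition \<beta> :: "'a \<Rightarrow> 'a \<Rightarrow> complex" where
  "\<beta> v y = cnj (A y) * dderiv v B y - B y * cnj (dderiv v A y)"

lemma Ck_frame: "Ck_on (Suc (Suc (Suc 0))) A U" "Ck_on (Suc (Suc (Suc 0))) B U"
  using A3 B3 by (simp_all add: numeral_3_eq_3)

lemma Ck_connection: "Ck_on (Suc (Suc 0)) (\<alpha> v) U" "Ck_on (Suc (Suc 0)) (\<beta> v) U"
  unfolding \<alpha>_def[abs_def] \<beta>_def[abs_def]
  by (intro Ck_on_intros open_U Ck_frame[THEN Ck_on_dderiv] Ck_frame[THEN Ck_on_SucD])+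

lemma diff_frame:
  "y \<in> U \<Longrightarrow> A differentiable (at y)" "y \<in> U \<Longrightarrow> B differentiable (at y)"
  "y \<in> U \<Longrightarrow> dderiv v A differentiable (at y)" "y \<in> U \<Longrightarrow> dderiv v B differentiable (at y)"
  "y \<in> U \<Longrightarrow> \<alpha> v differentiable (at y)" "y \<in> U \<Longrightarrow> \<beta> v differentiable (at y)"
  by (blast intro: Ck_on_differentiable Ck_frame Ck_on_dderiv Ck_connection)+

lemmas diff_intros = diff_frame differentiable_cnj differentiable_add differentiable_diff
  differentiable_mult differentiable_minus differentiable_const

text \<open>Differentiating det G = 1 gives \<alpha> + cnj \<alpha> = 0.\<close>

lemma cnj_alpha: assumes "y \<in> U" shows "cnj (\<alpha> v y) = - \<alpha> v y"
proof -
  have "dderiv v (\<lambda>y. A y * cnj (A y) - B y * cnj (B y)) y = dderiv v (\<lambda>y. 1) y"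
    by (rule dderiv_cong[OF open_U assms det])
  then have "A y * cnj (dderiv v A y) + dderiv v A y * cnj (A y)
      - (B y * cnj (dderiv v B y) + dderiv v B y * cnj (B y)) = 0"
    using assms by (simp add: dderiv_simps diff_intros)
  then show ?thesis by (simp add: \<alpha>_def algebra_simps)
qed

text \<open>With \<open>dderiv_B\<close>, this is the first row of dG = G (G^(-1) dG). It eliminates
  all derivatives of the frame.\<close>

lemma dderiv_A: assumes "y \<in> U" shows "dderiv v A y = A y * \<alpha> v y + B y * cnj (\<beta> v y)"
proof -
  have "A y * \<alpha> v y + B y * cnj (\<beta> v y) = (A y * cnj (A y) - B y * cnj (B y)) * dderiv v A y"
    by (simp add: \<alpha>_def \<beta>_def algebra_simps)
  then show ?thesis using det[OF assms] by simp
qed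

lemma dderiv_B: assumes "y \<in> U" shows "dderiv v B y = A y * \<beta> v y - B y * \<alpha> v y"
proof -
  have "A y * \<beta> v y + B y * cnj (\<alpha> v y) = (A y * cnj (A y) - B y * cnj (B y)) * dderiv v B y"
    by (simp add: \<alpha>_def \<beta>_def algebra_simps)
  then show ?thesis using det[OF assms] by (simp add: cnj_alpha[OF assms])
qed

lemma dderiv_cnj_alpha: assumes "y \<in> U" shows "cnj (dderiv w (\<alpha> v) y) = - dderiv w (\<alpha> v) y"
  using assms dderiv_cong[where v=w and f="\<lambda>x. cnj (\<alpha> v x)" and g="\<lambda>x. - \<alpha> v x", OF open_U assms cnj_alpha]
  by (simp add: dderiv_simps diff_intros)

text \<open>With M_v = G^(-1) d_v G, this and \<open>dderiv2_B\<close> are the first row of d_w d_v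
  G = G (M_w M_v + d_w M_v).\<close>

lemma dderiv2_A: assumes "y \<in> U"
  shows "dderiv w (dderiv v A) y = A y * (\<alpha> w y * \<alpha> v y + dderiv w (\<alpha> v) y + \<beta> w y * cnj (\<beta> v y))
    + B y * (cnj (\<beta> w y) * \<alpha> v y - \<alpha> w y * cnj (\<beta> v y) + cnj (dderiv w (\<beta> v) y))"
  using assms dderiv_cong[where v=w, OF open_U assms dderiv_A[of _ v]]
  by (simp add: dderiv_simps diff_intros dderiv_A dderiv_B algebra_simps)

lemma dderiv2_B: assumes "y \<in> U"
  shows "dderiv w (dderiv v B) y = A y * (\<alpha> w y * \<beta> v y + dderiv w (\<beta> v) y - \<beta> w y * \<alpha> v y)
    + B y * (cnj (\<beta> w y) * \<beta> v y + \<alpha> w y * \<alpha> v y - dderiv w (\<alpha> v) y)"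
  using assms dderiv_cong[where v=w, OF open_U assms dderiv_B[of _ v]]
  by (simp add: dderiv_simps diff_intros dderiv_A dderiv_B algebra_simps)

text \<open>This is d_v M_w - d_w M_v + [M_v, M_w] = 0 for M = G^(-1) dG. If N is the left side,
  with first row (E, F) and second row (cnj F, -E), symmetry of second derivatives gives G N = 0.
  Facts 1 and 2 are its first row, their conjugates its second, and det G = 1 forces N = 0.\<close>

lemma zero_curvature:
  assumes "y \<in> U"
  shows "dderiv v (\<alpha> w) y - dderiv w (\<alpha> v) y = \<beta> w y * cnj (\<beta> v y) - \<beta> v y * cnj (\<beta> w y)" (is ?diag)
    and "dderiv v (\<beta> w) y - dderiv w (\<beta> v) y = 2 * (\<alpha> w y * \<beta> v y - \<alpha> v y * \<beta> w y)" (is ?off)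
proof -
  define E where "E = dderiv v (\<alpha> w) y - dderiv w (\<alpha> v) y - (\<beta> w y * cnj (\<beta> v y) - \<beta> v y * cnj (\<beta> w y))"
  define F where "F = dderiv v (\<beta> w) y - dderiv w (\<beta> v) y - 2 * (\<alpha> w y * \<beta> v y - \<alpha> v y * \<beta> w y)"
  have C2: "Ck_on 2 A U" "Ck_on 2 B U"
    using Ck_frame[THEN Ck_on_SucD] by (simp_all add: numeral_2_eq_2)
  have 1: "A y * E + B y * cnj F = 0"
    using dderiv_commute[OF open_U C2(1) assms, of v w]
    by (simp add: dderiv2_A assms E_def F_def cnj_alpha algebra_simps)
  have 2: "A y * F - B y * E = 0"
    using dderiv_commute[OF open_U C2(2) assms, of v w]
    by (simp add: dderiv2_B assms E_def F_def algebra_simps)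
  have 3: "cnj E = - E"
    by (simp add: E_def dderiv_cnj_alpha assms)
  have 4: "cnj (A y) * E = cnj (B y) * F"
    using arg_cong[OF 1, of cnj] 3 by simp
  have 5: "cnj (B y) * E = - (cnj (A y) * cnj F)"
    using arg_cong[OF 2, of cnj] 3 by (simp add: eq_neg_iff_add_eq_0 add.commute)
  have "E = - E" "F = 0"
    using 1 2 4 5 det[OF assms] by algebra+
  then have "E = 0" "F = 0" by simp_all
  then show ?diag ?off by (simp_all add: E_def F_def)
qed

end

section \<open>The gauged Schroedinger map equation\<close>

text \<open>\<open>algebra\<close> treats \<i> as an indeterminate, so this relation is handed to it
  explicitly.\<close>

lemma i_times_i: "\<i> * \<i> = (-1 :: complex)" by simp

text \<open>\<open>W\<close> stands for \<open>s\<^sub>1 + \<i> s\<^sub>2\<close> and \<open>T\<close> for \<open>s\<^sub>3\<close>.\<close>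

locale su_schroedinger = su_frame U A B for U :: "spacetime set" and A B +
  fixes W T :: "spacetime \<Rightarrow> complex"
  assumes W: "\<And>y. y \<in> U \<Longrightarrow> W y = 2 * \<i> * A y * B y"
    and T: "\<And>y. y \<in> U \<Longrightarrow> T y = - (A y * cnj (A y) + B y * cnj (B y))"
    and schroedinger: "\<And>y. y \<in> U \<Longrightarrow> D_t W y = - \<i> * (T y * D_zbar (D_z W) y - W y * D_zbar (D_z T) y)"
begin

abbreviation e0 :: spacetime where "e0 \<equiv> (1, 0)"
abbreviation e1 :: spacetime where "e1 \<equiv> (0, axis 1 1)"
abbreviation e2 :: spacetime where "e2 \<equiv> (0, axis 2 1)"

lemma D_eq: "D_t f y = dderiv e0 f y" "D_x1 f y = dderiv e1 f y" "D_x2 f y = dderiv e2 f y"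
  by (simp_all add: D_t_def D_x1_def D_x2_def dderiv_def)

lemma D_complex_eq:
  "D_z f = (\<lambda>y. dderiv e1 f y - \<i> * dderiv e2 f y)" "D_zbar f = (\<lambda>y. dderiv e1 f y + \<i> * dderiv e2 f y)"
  by (simp_all add: D_z_def D_zbar_def D_eq fun_eq_iff)

text \<open>The cross terms cancel by symmetry, so both orders give the Laplacian. The second order
  occurs when \<open>D_z\<close> meets the \<open>D_zbar q\<close> inside beta_t.\<close>

lemma D_zbar_D_z: assumes "Ck_on (Suc (Suc 0)) f U" "y \<in> U"
  shows "D_zbar (D_z f) y = dderiv e1 (dderiv e1 f) y + dderiv e2 (dderiv e2 f) y"
    "D_z (D_zbar f) y = dderiv e1 (dderiv e1 f) y + dderiv e2 (dderiv e2 f) y"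
proof -
  have "dderiv v f differentiable at y" for v
    using assms by (blast intro: Ck_on_differentiable Ck_on_dderiv)
  moreover have "dderiv e1 (dderiv e2 f) y = dderiv e2 (dderiv e1 f) y"
    using dderiv_commute[OF open_U _ assms(2)] assms(1) by (simp add: numeral_2_eq_2)
  ultimately show "D_zbar (D_z f) y = dderiv e1 (dderiv e1 f) y + dderiv e2 (dderiv e2 f) y"
    "D_z (D_zbar f) y = dderiv e1 (dderiv e1 f) y + dderiv e2 (dderiv e2 f) y"
    by (simp_all add: D_complex_eq dderiv_simps diff_intros algebra_simps)
qed

text \<open>No \<alpha> appears: the diagonal part of G^(-1) dG commutes with \<open>sigma3\<close>
  and does not move S = -i G sigma3 G^(-1).\<close>

lemma dderiv_W: assumes "y \<in> U"
  shows "dderiv v W y = 2 * \<i> * (A y * A y * \<beta> v y + B y * B y * cnj (\<beta> v y))"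
  using assms dderiv_cong[where v=v, OF open_U assms W]
  by (simp add: dderiv_simps diff_intros dderiv_A dderiv_B algebra_simps)

lemma dderiv_T: assumes "y \<in> U"
  shows "dderiv v T y = - 2 * (cnj (A y) * B y * cnj (\<beta> v y) + A y * cnj (B y) * \<beta> v y)"
  using assms dderiv_cong[where v=v, OF open_U assms T]
  by (simp add: dderiv_simps diff_intros dderiv_A dderiv_B cnj_alpha algebra_simps)

text \<open>Here \<alpha> returns, inside the covariant derivative d_v \<beta>_v + 2 \<alpha>_v
  \<beta>_v. The last term equals 4 |\<beta>_v|^2 W, and its counterpart in \<open>dderiv2_T\<close>
  is 4 |\<beta>_v|^2 T: a multiple of \<open>S\<close>, invisible to the commutator.\<close>

lemma dderiv2_W: assumes "y \<in> U"
  shows "dderiv v (dderiv v W) y = 2 * \<i> * (A y * A y * (dderiv v (\<beta> v) y + 2 * \<alpha> v y * \<beta> v y)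
      + B y * B y * cnj (dderiv v (\<beta> v) y + 2 * \<alpha> v y * \<beta> v y) + 4 * A y * B y * \<beta> v y * cnj (\<beta> v y))"
  using assms dderiv_cong[where v=v, OF open_U assms dderiv_W[of _ v]]
  by (simp add: dderiv_simps diff_intros dderiv_A dderiv_B cnj_alpha algebra_simps)

lemma dderiv2_T: assumes "y \<in> U"
  shows "dderiv v (dderiv v T) y = - 2 * (A y * cnj (B y) * (dderiv v (\<beta> v) y + 2 * \<alpha> v y * \<beta> v y)
      + cnj (A y) * B y * cnj (dderiv v (\<beta> v) y + 2 * \<alpha> v y * \<beta> v y)
      + 2 * (A y * cnj (A y) + B y * cnj (B y)) * \<beta> v y * cnj (\<beta> v y))"
  using assms dderiv_cong[where v=v, OF open_U assms dderiv_T[of _ v]]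
  by (simp add: dderiv_simps diff_intros dderiv_A dderiv_B cnj_alpha algebra_simps)

lemma Ck_WT: "Ck_on (Suc (Suc 0)) W U" "Ck_on (Suc (Suc 0)) T U"
proof -
  have "Ck_on (Suc (Suc 0)) (\<lambda>y. 2 * \<i> * A y * B y) U"
    "Ck_on (Suc (Suc 0)) (\<lambda>y. - (A y * cnj (A y) + B y * cnj (B y))) U"
    by (intro Ck_on_intros open_U Ck_frame[THEN Ck_on_SucD])+
  then show "Ck_on (Suc (Suc 0)) W U" "Ck_on (Suc (Suc 0)) T U"
    by (simp_all only: W T cong: Ck_on_cong[OF open_U])
qed

text \<open>
  The \<open>W\<close> component of the equation alone suffices: it says \<open>A\<^sup>2 E + B\<^sup>2 (cnj E) = 0\<close> for the
  difference \<open>E\<close> of the two sides below, and \<open>|A| > |B|\<close>.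
\<close>

lemma beta_t: assumes "y \<in> U"
  shows "\<beta> e0 y = \<i> * (dderiv e1 (\<beta> e1) y + 2 * \<alpha> e1 y * \<beta> e1 y + (dderiv e2 (\<beta> e2) y + 2 * \<alpha> e2 y * \<beta> e2 y))"
    (is "_ = \<i> * (?R1 + ?R2)")
proof -
  define R1 R2 where "R1 = ?R1" and "R2 = ?R2"
  define E where "E = \<beta> e0 y - \<i> * (R1 + R2)"
  define a b where "a = A y" and "b = B y"
  have det': "a * cnj a - b * cnj b = 1" using det[OF assms] by (simp add: a_def b_def)
  have "2 * \<i> * (a * a * \<beta> e0 y + b * b * cnj (\<beta> e0 y)) =
     - \<i> * (- (a * cnj a + b * cnj b) *
        (2 * \<i> * (a * a * R1 + b * b * cnj R1 + 4 * a * b * \<beta> e1 y * cnj (\<beta> e1 y)) +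
         2 * \<i> * (a * a * R2 + b * b * cnj R2 + 4 * a * b * \<beta> e2 y * cnj (\<beta> e2 y)))
      - 2 * \<i> * a * b *
        (- 2 * (a * cnj b * R1 + cnj a * b * cnj R1 + 2 * (a * cnj a + b * cnj b) * \<beta> e1 y * cnj (\<beta> e1 y))
         - 2 * (a * cnj b * R2 + cnj a * b * cnj R2 + 2 * (a * cnj a + b * cnj b) * \<beta> e2 y * cnj (\<beta> e2 y))))"
    using schroedinger[OF assms]
    unfolding D_eq D_zbar_D_z[OF Ck_WT(1) assms] D_zbar_D_z[OF Ck_WT(2) assms]
      dderiv_W[OF assms] dderiv2_W[OF assms] dderiv2_T[OF assms] W[OF assms] T[OF assms]
    unfolding R1_def[symmetric] R2_def[symmetric] a_def[symmetric] b_def[symmetric]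
    by simp
  \<comment> \<open>The terms containing \<beta>_j cnj \<beta>_j cancel, and what is left collects
    the factor |a|^2 - |b|^2.\<close>
  also have "\<dots> = 2 * \<i> * (a * cnj a - b * cnj b) * (\<i> * (a * a * (R1 + R2)) - \<i> * (b * b * (cnj R1 + cnj R2)))"
    by (simp add: algebra_simps)
  finally have "2 * \<i> * (a * a * E + b * b * cnj E) = 0"
    unfolding det' by (simp add: E_def algebra_simps)
  then have "a * a * E = - (b * b * cnj E)" by (simp add: eq_neg_iff_add_eq_0)
  then have "norm (a * a * E) = norm (b * b * cnj E)" by simp
  then have "((norm a)\<^sup>2 - (norm b)\<^sup>2) * norm E = 0"
    by (simp add: norm_mult power2_eq_square algebra_simps)
  moreover have "(norm a)\<^sup>2 - (norm b)\<^sup>2 = 1"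
    using det' by (simp add: complex_norm_square[symmetric] flip: of_real_power of_real_diff)
  ultimately show ?thesis by (simp add: E_def R1_def R2_def)
qed

section \<open>The fields p, q, r, u and their equations\<close>

definition p where "p y = - (\<alpha> e1 y - \<i> * \<alpha> e2 y)"
definition q where "q y = - (\<beta> e1 y - \<i> * \<beta> e2 y)"
text \<open>Dictated, like \<open>p\<close> and \<open>q\<close>, by the form of G^(-1) G_z. The
  \<beta> are conjugated but \<i> is not, so \<open>r\<close> is in general different from the
  conjugate of \<open>q\<close>.\<close>

definition r where "r y = - (cnj (\<beta> e1 y) - \<i> * cnj (\<beta> e2 y))"
definition u where "u y = Im (\<alpha> e0 y)"

lemma Ck_pqr: "Ck_on (Suc (Suc 0)) p U" "Ck_on (Suc (Suc 0)) q U" "Ck_on (Suc (Suc 0)) r U"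
  "Ck_on (Suc (Suc 0)) u U"
  unfolding p_def[abs_def] q_def[abs_def] r_def[abs_def] u_def[abs_def]
  by (intro Ck_on_intros Ck_on_bounded_linear[OF _ bounded_linear_Im] open_U Ck_connection)+

lemma diff_pqr:
  "y \<in> U \<Longrightarrow> p differentiable (at y)" "y \<in> U \<Longrightarrow> q differentiable (at y)"
  "y \<in> U \<Longrightarrow> r differentiable (at y)"
  "y \<in> U \<Longrightarrow> dderiv v q differentiable (at y)" "y \<in> U \<Longrightarrow> dderiv v r differentiable (at y)"
  by (blast intro: Ck_on_differentiable Ck_on_dderiv Ck_pqr)+

lemma dderiv_p: "y \<in> U \<Longrightarrow> dderiv v p y = - (dderiv v (\<alpha> e1) y - \<i> * dderiv v (\<alpha> e2) y)"
  and dderiv_q: "y \<in> U \<Longrightarrow> dderiv v q y = - (dderiv v (\<beta> e1) y - \<i> * dderiv v (\<beta> e2) y)"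
  and dderiv_r: "y \<in> U \<Longrightarrow> dderiv v r y = - (cnj (dderiv v (\<beta> e1) y) - \<i> * cnj (dderiv v (\<beta> e2) y))"
  unfolding p_def[abs_def] q_def[abs_def] r_def[abs_def]
  by (simp_all add: dderiv_simps diff_intros)

lemma cnj_p: "y \<in> U \<Longrightarrow> cnj (p y) = \<alpha> e1 y + \<i> * \<alpha> e2 y"
  by (simp add: p_def cnj_alpha)

lemma alpha_t: "y \<in> U \<Longrightarrow> \<alpha> e0 y = \<i> * complex_of_real (u y)"
  using cnj_alpha[of y e0] by (simp add: u_def complex_eq_iff)

text \<open>The symmetric parts of the right side form the covariant divergence in
  \<open>beta_t\<close>. The antisymmetric ones, a curl of \<beta> and a commutator term, cancel by
  the off-diagonal curvature in the (x1, x2) plane.\<close>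

lemma beta_t_q: "y \<in> U \<Longrightarrow> \<beta> e0 y = \<i> * (- D_zbar q y - 2 * cnj (p y) * q y)"
  using zero_curvature(2)[of y e1 e2]
  by (simp add: beta_t D_complex_eq dderiv_q cnj_p q_def) (use i_times_i in algebra)

lemma beta_t_r: "y \<in> U \<Longrightarrow> cnj (\<beta> e0 y) = \<i> * (D_zbar r y - 2 * cnj (p y) * r y)"
  using arg_cong[OF zero_curvature(2)[of y e1 e2], of cnj]
  by (simp add: beta_t D_complex_eq dderiv_r cnj_p r_def cnj_alpha) (use i_times_i in algebra)

text \<open>On the left the divergence of \<alpha> cancels and 2 \<i> times its curl remains, which
  is the diagonal curvature. \<open>curl_qr\<close> is the same for \<beta> and the off-diagonal
  curvature.\<close>

lemma div_p:
  assumes "y \<in> U"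
  shows "D_z (\<lambda>x. cnj (p x)) y + D_zbar p y =
    - complex_of_real ((cmod (q y))\<^sup>2) + complex_of_real ((cmod (r y))\<^sup>2)"
  using zero_curvature(1)[of y e1 e2] assms
  unfolding complex_norm_square
  by (simp add: D_complex_eq dderiv_cnj diff_pqr dderiv_p dderiv_cnj_alpha q_def r_def) (use i_times_i in algebra)

lemma curl_qr:
  assumes "y \<in> U"
  shows "- D_z (\<lambda>x. cnj (r x)) y + D_zbar q y = - 2 * (p y * cnj (r y) + cnj (p y) * q y)"
  using zero_curvature(2)[of y e1 e2] assms
  unfolding D_complex_eq dderiv_cnj[OF diff_pqr(3)[OF assms]]
  by (simp add: dderiv_q dderiv_r cnj_alpha p_def q_def r_def) (use i_times_i in algebra)

text \<open>The diagonal curvature for (time, x1) minus \<i> times that for (time, x2); the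
  contributions of cnj p to beta_t cancel, leaving the derivative of the product q r.\<close>

lemma evolution_p:
  assumes "y \<in> U"
  shows "\<i> * D_t p y + D_zbar (\<lambda>x. q x * r x) y - D_z (\<lambda>x. complex_of_real (u x)) y = 0"
proof -
  have u: "\<i> * dderiv v (\<lambda>x. complex_of_real (u x)) y = dderiv v (\<alpha> e0) y" for v
  proof -
    have "dderiv v (\<alpha> e0) y = dderiv v (\<lambda>x. \<i> * complex_of_real (u x)) y"
      by (rule dderiv_cong[OF open_U assms alpha_t])
    also have "\<dots> = \<i> * dderiv v (\<lambda>x. complex_of_real (u x)) y"
      by (rule dderiv_cmult, rule differentiable_bounded_linear[OF bounded_linear_of_real])
        (rule Ck_on_differentiable[OF Ck_pqr(4) assms])
    finally show ?thesis by simp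
  qed
  have 1: "D_t p y = - (D_z (\<alpha> e0) y) + q y * cnj (\<beta> e0 y) - r y * \<beta> e0 y"
    using zero_curvature(1)[OF assms, of e0 e1] zero_curvature(1)[OF assms, of e0 e2]
    by (simp add: D_eq D_complex_eq dderiv_p assms q_def r_def) (use i_times_i in algebra)
  have 2: "D_z (\<alpha> e0) y = \<i> * D_z (\<lambda>x. complex_of_real (u x)) y"
    by (simp add: D_complex_eq algebra_simps flip: u)
  have 3: "D_zbar (\<lambda>x. q x * r x) y = q y * D_zbar r y + D_zbar q y * r y"
    by (simp add: D_complex_eq dderiv_mult diff_pqr assms algebra_simps)
  show ?thesis
    \<comment> \<open>The conjugate of \<open>\<beta> e0 y\<close> is replaced before
      \<open>\<beta> e0 y\<close> itself; otherwise it would be expressed by \<open>q\<close>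
      instead of \<open>r\<close>.\<close>
    unfolding 1 2 3 beta_t_r[OF assms] unfolding beta_t_q[OF assms] by (simp add: algebra_simps)
qed

lemma D_z_beta_t:
  assumes "y \<in> U"
  shows "D_z (\<beta> e0) y = - \<i> * (D_zbar (D_z q) y + 2 * D_z (\<lambda>x. cnj (p x) * q x) y)"
    and "D_z (\<lambda>x. cnj (\<beta> e0 x)) y = \<i> * (D_zbar (D_z r) y - 2 * D_z (\<lambda>x. cnj (p x) * r x) y)"
proof -
  have c: "D_z (\<beta> e0) y = D_z (\<lambda>x. \<i> * (- D_zbar q x - 2 * (cnj (p x) * q x))) y"
    "D_z (\<lambda>x. cnj (\<beta> e0 x)) y = D_z (\<lambda>x. \<i> * (D_zbar r x - 2 * (cnj (p x) * r x))) y"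
    unfolding D_complex_eq[of "\<beta> e0"] D_complex_eq(1)[of "\<lambda>x. cnj (\<beta> e0 x)"]
      D_complex_eq(1)[of "\<lambda>x. \<i> * _ x"]
    using dderiv_cong[OF open_U assms beta_t_q] dderiv_cong[OF open_U assms beta_t_r]
    by (simp_all add: mult.assoc)
  have d: "D_zbar q differentiable (at y)" "D_zbar r differentiable (at y)"
    unfolding D_complex_eq by (intro diff_intros diff_pqr assms)+
  have m: "(\<lambda>x. cnj (p x) * q x) differentiable (at y)" "(\<lambda>x. cnj (p x) * r x) differentiable (at y)"
    by (intro diff_intros diff_pqr assms)+
  show "D_z (\<beta> e0) y = - \<i> * (D_zbar (D_z q) y + 2 * D_z (\<lambda>x. cnj (p x) * q x) y)"
    unfolding c D_zbar_D_z(1)[OF Ck_pqr(2) assms] D_zbar_D_z(2)[OF Ck_pqr(2) assms, symmetric]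
    by (simp add: D_complex_eq(1) dderiv_add dderiv_diff dderiv_minus dderiv_cmult d m diff_intros)
      (simp add: algebra_simps)
  show "D_z (\<lambda>x. cnj (\<beta> e0 x)) y = \<i> * (D_zbar (D_z r) y - 2 * D_z (\<lambda>x. cnj (p x) * r x) y)"
    unfolding c D_zbar_D_z(1)[OF Ck_pqr(3) assms] D_zbar_D_z(2)[OF Ck_pqr(3) assms, symmetric]
    by (simp add: D_complex_eq(1) dderiv_add dderiv_diff dderiv_minus dderiv_cmult d m diff_intros)
      (simp add: algebra_simps)
qed

text \<open>The same combination of off-diagonal curvatures. The term 2 p \<beta>_t produces both
  the p q_zbar term and the cubic one; D_z \<beta>_t produces the second order part.\<close>

lemma evolution_q:
  assumes "y \<in> U"
  shows "\<i> * D_t q y + D_zbar (D_z q) y - 2 * complex_of_real (u y) * q y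
          + 2 * D_z (\<lambda>x. cnj (p x) * q x) y - 2 * p y * D_zbar q y
          - 4 * complex_of_real ((cmod (p y))\<^sup>2) * q y = 0"
proof -
  have *: "D_t q y = - D_z (\<beta> e0) y - 2 * \<alpha> e0 y * q y + 2 * p y * \<beta> e0 y"
    using zero_curvature(2)[OF assms, of e0 e1] zero_curvature(2)[OF assms, of e0 e2]
    by (simp add: D_eq D_complex_eq dderiv_q assms q_def p_def) (use i_times_i in algebra)
  show ?thesis
    unfolding complex_norm_square * D_z_beta_t[OF assms] alpha_t[OF assms] beta_t_q[OF assms]
    by (simp add: algebra_simps)
qed

lemma evolution_r:
  assumes "y \<in> U"
  shows "\<i> * D_t r y - D_zbar (D_z r) y + 2 * complex_of_real (u y) * r y
          + 2 * D_z (\<lambda>x. cnj (p x) * r x) y - 2 * p y * D_zbar r y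
          + 4 * complex_of_real ((cmod (p y))\<^sup>2) * r y = 0"
proof -
  have *: "D_t r y = - D_z (\<lambda>x. cnj (\<beta> e0 x)) y + 2 * \<alpha> e0 y * r y - 2 * p y * cnj (\<beta> e0 y)"
    using arg_cong[OF zero_curvature(2)[OF assms, of e0 e1], of cnj]
      arg_cong[OF zero_curvature(2)[OF assms, of e0 e2], of cnj]
    by (simp add: D_eq D_complex_eq dderiv_r dderiv_cnj diff_frame cnj_alpha assms r_def p_def) (use i_times_i in algebra)
  show ?thesis
    unfolding complex_norm_square * D_z_beta_t[OF assms] alpha_t[OF assms] beta_t_r[OF assms]
    by (simp add: algebra_simps)
qed

end

section \<open>Matrices\<close>

lemma mat2_nth [simp]:
  "mat2 a b c d $ 1 $ 1 = a" "mat2 a b c d $ 1 $ 2 = b"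
  "mat2 a b c d $ 2 $ 1 = c" "mat2 a b c d $ 2 $ 2 = d"
  by (simp_all add: mat2_def)

lemma mat2_eq_iff: "X = mat2 a b c d \<longleftrightarrow> X $ 1 $ 1 = a \<and> X $ 1 $ 2 = b \<and> X $ 2 $ 1 = c \<and> X $ 2 $ 2 = d"
  by (auto simp: vec_eq_iff forall_2)

lemma matrix_mult_nth2: "((X :: complex^2^2) ** Y) $ i $ j = X $ i $ 1 * Y $ 1 $ j + X $ i $ 2 * Y $ 2 $ j"
  by (simp add: matrix_matrix_mult_def sum_2)

lemma mat2_mult: "mat2 a b c d ** mat2 a' b' c' d'
    = mat2 (a * a' + b * c') (a * b' + b * d') (c * a' + d * c') (c * b' + d * d')"
  by (simp add: mat2_eq_iff matrix_mult_nth2)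

lemma mat2_add: "mat2 a b c d + mat2 a' b' c' d' = mat2 (a + a') (b + b') (c + c') (d + d')"
  and mat2_diff: "mat2 a b c d - mat2 a' b' c' d' = mat2 (a - a') (b - b') (c - c') (d - d')"
  and mat2_minus: "- mat2 a b c d = mat2 (- a) (- b) (- c) (- d)"
  and cscale_mat2: "k *\<^sub>M mat2 a b c d = mat2 (k * a) (k * b) (k * c) (k * d)"
  by (simp_all add: mat2_eq_iff cscale_def map_matrix_def)

lemma cscale_nth: "(k *\<^sub>M X) $ i $ j = k * X $ i $ j"
  by (simp add: cscale_def map_matrix_def)

text \<open>\<open>matrix_inv\<close> is a choice; the adjugate shows that a two-sided inverse
  exists, and uniqueness of inverses identifies the chosen one.\<close>

lemma matrix_inv_mat2:
  assumes "a * d - b * c = 1"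
  shows "matrix_inv (mat2 a b c d) = mat2 d (- b) (- c) a"
proof -
  have one: "mat 1 = mat2 1 0 0 1" by (simp add: mat2_eq_iff mat_def)
  have l: "mat2 d (- b) (- c) a ** mat2 a b c d = mat 1"
    and r: "mat2 a b c d ** mat2 d (- b) (- c) a = mat 1"
    using assms by (simp_all add: mat2_mult one algebra_simps)
  have "mat2 a b c d ** matrix_inv (mat2 a b c d) = mat 1 \<and> matrix_inv (mat2 a b c d) ** mat2 a b c d = mat 1"
    unfolding matrix_inv_def by (rule someI[of _ "mat2 d (- b) (- c) a"]) (simp add: l r)
  then show ?thesis
    by (metis l matrix_mul_assoc matrix_mul_lid matrix_mul_rid)
qed

lemma bounded_linear_mat2:
  "bounded_linear (\<lambda>z. mat2 z 0 0 0)" "bounded_linear (\<lambda>z. mat2 0 z 0 0)"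
  "bounded_linear (\<lambda>z. mat2 0 0 z 0)" "bounded_linear (\<lambda>z. mat2 0 0 0 z)"
  by (auto intro!: linear_conv_bounded_linear[THEN iffD1] linearI simp: vec_eq_iff forall_2)

text \<open>A sum of bounded linear images of the entries, which carries the scalar calculus over to
  matrices.\<close>

lemma mat2_split: "mat2 a b c d = mat2 a 0 0 0 + mat2 0 b 0 0 + mat2 0 0 c 0 + mat2 0 0 0 d"
  by (simp add: mat2_add)

lemma dderiv_mat2:
  assumes "a differentiable (at y)" "b differentiable (at y)" "c differentiable (at y)" "d differentiable (at y)"
  shows "dderiv v (\<lambda>x. mat2 (a x) (b x) (c x) (d x)) y
    = mat2 (dderiv v a y) (dderiv v b y) (dderiv v c y) (dderiv v d y)"
  unfolding mat2_split[of "a _" "b _" "c _" "d _"] mat2_split[of "dderiv v a y" "dderiv v b y" "dderiv v c y" "dderiv v d y"]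
  using assms
  by (simp add: dderiv_add differentiable_add bounded_linear_mat2[THEN dderiv_bounded_linear]
      bounded_linear_mat2[THEN differentiable_bounded_linear])

lemma Ck_on_mat2:
  assumes "open U" "Ck_on k a U" "Ck_on k b U" "Ck_on k c U" "Ck_on k d U"
  shows "Ck_on k (\<lambda>x. mat2 (a x) (b x) (c x) (d x)) U"
  unfolding mat2_split[of "a _" "b _" "c _" "d _"]
  by (intro Ck_on_add assms bounded_linear_mat2[THEN Ck_on_bounded_linear[OF assms(1)]])

lemma bounded_linear_entry: "bounded_linear (\<lambda>X :: complex^2^2. X $ i $ j)"
  by (rule bounded_linear_compose[OF bounded_linear_vec_nth bounded_linear_vec_nth])

lemma MD_nth:
  assumes "F differentiable (at y)"
  shows "D_t F y $ i $ j = D_t (\<lambda>x. F x $ i $ j) y"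
    and "MD_z F y $ i $ j = D_z (\<lambda>x. F x $ i $ j) y"
    and "MD_zbar F y $ i $ j = D_zbar (\<lambda>x. F x $ i $ j) y"
proof -
  have *: "frechet_derivative (\<lambda>x. F x $ i $ j) (at y) v = frechet_derivative F (at y) v $ i $ j" for v
    using dderiv_bounded_linear[OF bounded_linear_entry assms] unfolding dderiv_def .
  show "D_t F y $ i $ j = D_t (\<lambda>x. F x $ i $ j) y"
    "MD_z F y $ i $ j = D_z (\<lambda>x. F x $ i $ j) y"
    "MD_zbar F y $ i $ j = D_zbar (\<lambda>x. F x $ i $ j) y"
    by (simp_all add: D_t_def MD_z_def MD_zbar_def D_z_def D_zbar_def D_x1_def D_x2_def * cscale_nth)
qed

lemma D_complex_cong:
  assumes "open U" "y \<in> U" "\<And>x. x \<in> U \<Longrightarrow> f x = g x"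
  shows "D_z f y = D_z g y" "D_zbar f y = D_zbar g y"
  using dderiv_cong[OF assms] by (simp_all add: D_z_def D_zbar_def D_x1_def D_x2_def dderiv_def)

lemma D_complex_cmult:
  assumes "f differentiable (at y)"
  shows "D_z (\<lambda>x. k * f x) y = k * D_z f y" "D_zbar (\<lambda>x. k * f x) y = k * D_zbar f y"
  using dderiv_cmult[OF assms, of _ k]
  by (simp_all add: D_z_def D_zbar_def D_x1_def D_x2_def dderiv_def algebra_simps)

lemma D_zbar_D_z_cmult:
  assumes "open U" "Ck_on (Suc (Suc 0)) f U" "y \<in> U" "\<And>x. x \<in> U \<Longrightarrow> g x = k * f x"
  shows "D_zbar (D_z g) y = k * D_zbar (D_z f) y"
proof -
  have f: "f differentiable (at x)" "dderiv v f differentiable (at x)" if "x \<in> U" for x v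
    using that assms(2) by (blast intro: Ck_on_differentiable Ck_on_dderiv)+
  have d: "D_z f differentiable (at y)"
    using differentiable_diff[OF f(2) differentiable_mult[OF differentiable_const f(2)], OF assms(3,3)]
    by (simp add: D_z_def[abs_def] D_x1_def[abs_def] D_x2_def[abs_def] dderiv_def[abs_def])
  have "D_zbar (D_z g) y = D_zbar (\<lambda>x. k * D_z f x) y"
    by (rule D_complex_cong(2)[OF assms(1,3)])
      (simp add: D_complex_cong(1)[OF assms(1) _ assms(4)] D_complex_cmult f)
  then show ?thesis by (simp add: D_complex_cmult d)
qed

lemma differentiable_cscale:
  assumes "F differentiable (at y)" shows "(\<lambda>x. k *\<^sub>M F x) differentiable (at y)"
  by (rule differentiable_bounded_linear[OF _ assms], intro linear_conv_bounded_linear[THEN iffD1] linearI)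
    (simp_all add: vec_eq_iff cscale_nth algebra_simps)

lemma MD_zbar_MD_z_nth:
  assumes "open U" "Ck_on (Suc (Suc 0)) F U" "y \<in> U"
  shows "MD_zbar (MD_z F) y $ i $ j = D_zbar (D_z (\<lambda>x. F x $ i $ j)) y"
proof -
  have F: "F differentiable (at x)" "dderiv v F differentiable (at x)" if "x \<in> U" for x v
    using that assms(2) by (blast intro: Ck_on_differentiable Ck_on_dderiv)+
  have "MD_z F differentiable (at y)"
    using differentiable_diff[OF F(2) differentiable_cscale[OF F(2)], OF assms(3,3)]
    by (simp add: MD_z_def[abs_def] D_x1_def[abs_def] D_x2_def[abs_def] dderiv_def[abs_def])
  then have "MD_zbar (MD_z F) y $ i $ j = D_zbar (\<lambda>x. MD_z F x $ i $ j) y" by (rule MD_nth)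
  also have "\<dots> = D_zbar (D_z (\<lambda>x. F x $ i $ j)) y"
    by (rule D_complex_cong(2)[OF assms(1,3)]) (rule MD_nth(2)[OF F(1)])
  finally show ?thesis .
qed

section \<open>Existence of the gauge\<close>

context su_schroedinger
begin

definition G where "G y = mat2 (A y) (B y) (cnj (B y)) (cnj (A y))"

lemma G_SU11: "y \<in> U \<Longrightarrow> G y \<in> SU11"
proof -
  assume "y \<in> U"
  have "complex_of_real ((cmod (A y))\<^sup>2 - (cmod (B y))\<^sup>2) = of_real 1"
    using det[OF \<open>y \<in> U\<close>] by (simp only: of_real_diff complex_norm_square of_real_1)
  then have "(cmod (A y))\<^sup>2 - (cmod (B y))\<^sup>2 = 1" by (simp only: of_real_eq_iff)
  then show ?thesis unfolding SU11_def G_def by blast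
qed

lemma matrix_inv_G: "y \<in> U \<Longrightarrow> matrix_inv (G y) = mat2 (cnj (A y)) (- B y) (- cnj (B y)) (A y)"
  unfolding G_def by (rule matrix_inv_mat2) (rule det)

lemma dderiv_G: "y \<in> U \<Longrightarrow>
  dderiv v G y = mat2 (dderiv v A y) (dderiv v B y) (cnj (dderiv v B y)) (cnj (dderiv v A y))"
  unfolding G_def[abs_def] by (simp add: dderiv_mat2 dderiv_cnj diff_intros)

lemma connection_G: "y \<in> U \<Longrightarrow>
  matrix_inv (G y) ** dderiv v G y = mat2 (\<alpha> v y) (\<beta> v y) (cnj (\<beta> v y)) (- \<alpha> v y)"
  using cnj_alpha[of y v]
  by (simp add: matrix_inv_G dderiv_G mat2_mult mat2_eq_iff \<alpha>_def \<beta>_def algebra_simps)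

lemma matrix_mult_complex_comb:
  fixes X Y Z :: "complex^2^2"
  shows "X ** (Y + k *\<^sub>M Z) = X ** Y + k *\<^sub>M (X ** Z)" "X ** (Y - k *\<^sub>M Z) = X ** Y - k *\<^sub>M (X ** Z)"
  by (simp_all add: vec_eq_iff matrix_mult_nth2 cscale_nth algebra_simps)

lemma gauge_transforms:
  assumes S: "\<And>y. y \<in> U \<Longrightarrow> S y = mat2 (\<i> * T y) (W y) (cnj (W y)) (- \<i> * T y)"
  shows "gauge_transforms U G S p q r u"
  unfolding gauge_transforms_def
proof (intro conjI ballI)
  show "Ck_on 1 G U" "Ck_on 1 q U" "Ck_on 1 r U"
    unfolding G_def[abs_def] One_nat_def
    by (intro Ck_on_mat2 Ck_on_intros open_U Ck_frame[THEN Ck_on_SucD, THEN Ck_on_SucD]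
        Ck_pqr[THEN Ck_on_SucD])+
  fix y assume y: "y \<in> U"
  show "G y \<in> SU11" by (rule G_SU11[OF y])
  define a b where "a = A y" and "b = B y"
  have det': "a * cnj a - b * cnj b = 1" using det[OF y] by (simp add: a_def b_def)
  \<comment> \<open>Since S = -i G sigma3 adj(G), conjugation yields (det G)^2 sigma3: a ring
    identity, checked before det G = 1 is inserted.\<close>
  have "\<i> *\<^sub>M (mat2 (cnj a) (- b) (- cnj b) a **
      mat2 (\<i> * - (a * cnj a + b * cnj b)) (2 * \<i> * a * b) (cnj (2 * \<i> * a * b)) (- \<i> * - (a * cnj a + b * cnj b)) **
      mat2 a b (cnj b) (cnj a)) = mat2 ((a * cnj a - b * cnj b)\<^sup>2) 0 0 (- (a * cnj a - b * cnj b)\<^sup>2)"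
    by (simp add: mat2_mult cscale_mat2 mat2_eq_iff power2_eq_square algebra_simps)
  then show "sigma3 = \<i> *\<^sub>M (matrix_inv (G y) ** S y ** G y)"
    unfolding det' matrix_inv_G[OF y] S[OF y] W[OF y] T[OF y] sigma3_def
    unfolding G_def by (simp add: a_def b_def)
  show "matrix_inv (G y) ** MD_z G y = - mat2 (p y) (q y) (r y) (- p y)"
    unfolding MD_z_def D_eq matrix_mult_complex_comb connection_G[OF y]
    by (simp add: cscale_mat2 mat2_diff mat2_minus mat2_eq_iff p_def q_def r_def)
  show "matrix_inv (G y) ** MD_zbar G y =
      mat2 (cnj (p y)) (- cnj (r y)) (- cnj (q y)) (- cnj (p y))"
    unfolding MD_zbar_def D_eq matrix_mult_complex_comb connection_G[OF y]
    by (simp add: cscale_mat2 mat2_add mat2_eq_iff cnj_p y q_def r_def)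
  show "matrix_inv (G y) ** D_t G y = \<i> *\<^sub>M mat2 (complex_of_real (u y)) (- D_zbar q y - 2 * cnj (p y) * q y)
      (D_zbar r y - 2 * cnj (p y) * r y) (- complex_of_real (u y))"
    unfolding D_eq connection_G[OF y] cscale_mat2
    by (simp only: beta_t_r[OF y]) (simp add: mat2_eq_iff beta_t_q[OF y] alpha_t[OF y])
qed

lemma gauged_system_solution: "gauged_system_solution U p q r u"
  unfolding gauged_system_solution_def
  using evolution_q evolution_r evolution_p div_p curl_qr Ck_pqr(2,3) Ck_pqr(1,4)[THEN Ck_on_SucD]
  by (simp add: numeral_2_eq_2 del: Ck_on.simps)

end

theorem theorem1:
  fixes I :: "real set"
    and S :: "real \<times> (real^2) \<Rightarrow> complex^2^2"
    and s1 s2 s3 :: "real \<times> (real^2) \<Rightarrow> real"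
  assumes "open I" and "is_interval I"
    and "S ` (I \<times> UNIV) \<subseteq> su11"
    and "Ck_on 3 S (I \<times> UNIV)"
    and "\<forall>y \<in> I \<times> UNIV.
           S y = mat2 (\<i> * complex_of_real (s3 y))
                      (complex_of_real (s1 y) + \<i> * complex_of_real (s2 y))
                      (complex_of_real (s1 y) - \<i> * complex_of_real (s2 y))
                      (- \<i> * complex_of_real (s3 y)) \<and>
           (s1 y)\<^sup>2 + (s2 y)\<^sup>2 - (s3 y)\<^sup>2 = -1 \<and>
           s3 y < 0"
    and "\<forall>y \<in> I \<times> UNIV.
           D_t S y = - (1/2) *\<^sub>R commutator (S y) (MD_zbar (MD_z S) y)"
  shows "\<exists>(G :: real \<times> (real^2) \<Rightarrow> complex^2^2)
           (p :: real \<times> (real^2) \<Rightarrow> complex) (q :: real \<times> (real^2) \<Rightarrow> complex)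
           (r :: real \<times> (real^2) \<Rightarrow> complex) (u :: real \<times> (real^2) \<Rightarrow> real).
           gauge_transforms (I \<times> UNIV) G S p q r u \<and>
           gauged_system_solution (I \<times> UNIV) p q r u"
proof -
  define U where "U = I \<times> (UNIV :: (real^2) set)"
  note hyp = assms(4-6)[folded U_def]
  have U: "open U" unfolding U_def by (intro open_Times assms(1) open_UNIV)
  have S: "S y = mat2 (\<i> * complex_of_real (s3 y)) (complex_of_real (s1 y) + \<i> * complex_of_real (s2 y))
      (complex_of_real (s1 y) - \<i> * complex_of_real (s2 y)) (- \<i> * complex_of_real (s3 y))"
    and hyperboloid: "(s1 y)\<^sup>2 + (s2 y)\<^sup>2 - (s3 y)\<^sup>2 = -1" and neg: "s3 y < 0" if "y \<in> U" for y
    using hyp(2) that by blast+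
  \<comment> \<open>\<open>W\<close> and \<open>T\<close> are read off from \<open>S\<close>, whose
    smoothness is given, rather than from \<open>s1\<close>, \<open>s2\<close>,
    \<open>s3\<close>.\<close>
  define W where "W y = S y $ 1 $ 2" for y
  define T where "T y = - \<i> * S y $ 1 $ 1" for y
  \<comment> \<open>Adding |A|^2 + |B|^2 = -s3 and |A|^2 - |B|^2 = 1 gives the radicand;
    \<open>B\<close> then solves W = 2 i A B.\<close>
  define h where "h y = sqrt ((1 - Re (T y)) / 2)" for y
  define A where "A y = complex_of_real (h y)" for y
  define B where "B y = - \<i> / 2 * W y * complex_of_real (inverse (h y))" for y
  have W: "W y = complex_of_real (s1 y) + \<i> * complex_of_real (s2 y)"
    and T: "T y = complex_of_real (s3 y)" if "y \<in> U" for y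
    using S[OF that] by (simp_all add: W_def T_def)
  have h_pos: "h y > 0" and h_sq: "(h y)\<^sup>2 = (1 - s3 y) / 2" if "y \<in> U" for y
    using neg[OF that] T[OF that] by (simp_all add: h_def)
  have normW: "W y * cnj (W y) = complex_of_real ((s3 y)\<^sup>2 - 1)" if "y \<in> U" for y
    using hyperboloid[OF that] W[OF that]
    by (simp add: complex_eq_iff power2_eq_square algebra_simps)
  have AA: "A y * cnj (A y) = complex_of_real ((1 - s3 y) / 2)" if "y \<in> U" for y
    unfolding h_sq[OF that, symmetric] by (simp add: A_def power2_eq_square)
  have BB: "B y * cnj (B y) = complex_of_real (- (1 + s3 y) / 2)" if "y \<in> U" for y
  proof -
    have "B y * cnj (B y) = W y * cnj (W y) * complex_of_real (inverse ((h y)\<^sup>2) / 4)"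
      by (simp add: B_def power2_eq_square) (use i_times_i in algebra)
    also have "\<dots> = complex_of_real (((s3 y)\<^sup>2 - 1) * (inverse ((1 - s3 y) / 2) / 4))"
      unfolding normW[OF that] h_sq[OF that] of_real_mult ..
    also have "((s3 y)\<^sup>2 - 1) * (inverse ((1 - s3 y) / 2) / 4) = - (1 + s3 y) / 2"
    proof -
      \<comment> \<open>The factor 1 - s3 is positive and cancels against the square of
        \<open>h\<close>.\<close>
      have factor: "(s3 y)\<^sup>2 - 1 = (1 - s3 y) * - (1 + s3 y)" by (simp add: power2_eq_square algebra_simps)
      have "c * d * (inverse (c / 2) / 4) = d / 2" if "c \<noteq> 0" for c d :: real
        using that by simp
      from this[of "1 - s3 y" "- (1 + s3 y)"] neg[OF that] show ?thesis
        unfolding factor by simp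
    qed
    finally show ?thesis .
  qed
  have C3: "Ck_on 3 (\<lambda>y. S y $ i $ j) U" for i j
    using Ck_on_bounded_linear[OF U bounded_linear_entry[of i j] hyp(1)] .
  have T3: "Ck_on 3 T U" and W3: "Ck_on 3 W U"
    unfolding T_def[abs_def] W_def[abs_def] by (rule Ck_on_cmult[OF U C3], rule C3)
  have h3: "Ck_on 3 h U"
  proof -
    have "Ck_on 3 (\<lambda>y. (1 - Re (T y)) * (1/2)) U"
      by (intro Ck_on_intros U T3 Ck_on_bounded_linear[OF _ bounded_linear_Re])
    then show ?thesis
      unfolding h_def[abs_def] by (intro Ck_on_sqrt U) (use neg T in force)+
  qed
  have A3: "Ck_on 3 A U"
    unfolding A_def[abs_def] by (rule Ck_on_bounded_linear[OF U bounded_linear_of_real h3])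
  have B3: "Ck_on 3 B U"
    unfolding B_def[abs_def]
    by (intro Ck_on_intros U W3 Ck_on_bounded_linear[OF U bounded_linear_of_real] Ck_on_inverse h3)
      (use h_pos in force)
  have S2: "Ck_on (Suc (Suc 0)) S U"
    using Ck_on_mono[OF hyp(1)] by (simp add: numeral_2_eq_2 del: Ck_on.simps)
  interpret frame: su_schroedinger U A B W T
  proof
    show "open U" "Ck_on 3 A U" "Ck_on 3 B U" by fact+
    fix y assume y: "y \<in> U"
    show "A y * cnj (A y) - B y * cnj (B y) = 1"
      unfolding AA[OF y] BB[OF y] by (simp add: field_simps flip: of_real_diff)
    show "W y = 2 * \<i> * A y * B y"
    proof -
      have "complex_of_real (h y) * inverse (complex_of_real (h y)) = 1" using h_pos[OF y] by simp
      then show ?thesis by (simp add: A_def B_def) (use i_times_i in algebra)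
    qed
    show "T y = - (A y * cnj (A y) + B y * cnj (B y))"
      unfolding AA[OF y] BB[OF y] T[OF y] by (simp add: complex_eq_iff field_simps)
    have lap: "MD_zbar (MD_z S) y $ i $ j = D_zbar (D_z (\<lambda>x. S x $ i $ j)) y" for i j
      by (rule MD_zbar_MD_z_nth[OF U S2 y])
    have entries: "S x $ 1 $ 1 = \<i> * T x" "S x $ 2 $ 2 = - \<i> * T x" "S x $ 1 $ 2 = W x"
      if "x \<in> U" for x
      using S[OF that] T[OF that] W[OF that] by simp_all
    have T2: "Ck_on (Suc (Suc 0)) T U"
      using Ck_on_mono[OF T3] by (simp add: numeral_2_eq_2 del: Ck_on.simps)
    note lap_T = D_zbar_D_z_cmult[where g = "\<lambda>x. S x $ 1 $ 1", OF U T2 y entries(1)]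
      D_zbar_D_z_cmult[where g = "\<lambda>x. S x $ 2 $ 2", OF U T2 y entries(2)]
    have "D_t W y = D_t S y $ 1 $ 2"
      unfolding W_def[abs_def] by (rule MD_nth(1)[OF Ck_on_differentiable[OF S2 y], symmetric])
    also have "\<dots> = (- (1/2) *\<^sub>R commutator (S y) (MD_zbar (MD_z S) y)) $ 1 $ 2"
      using hyp(3) y by simp
    \<comment> \<open>The diagonal entries of \<open>S\<close> are opposite, so both halves of the
      commutator contribute equally and the entry is 2 \<i> times the bracket.\<close>
    also have "\<dots> = - \<i> * (T y * D_zbar (D_z W) y - W y * D_zbar (D_z T) y)"
      by (simp add: commutator_def matrix_mult_nth2 lap lap_T entries[OF y] W_def[abs_def, symmetric])
        (simp add: scaleR_conv_of_real algebra_simps)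
    finally show "D_t W y = - \<i> * (T y * D_zbar (D_z W) y - W y * D_zbar (D_z T) y)" .
  qed
  have "gauge_transforms U frame.G S frame.p frame.q frame.r frame.u"
    by (rule frame.gauge_transforms) (simp add: S W T)
  with frame.gauged_system_solution show ?thesis unfolding U_def by blast
qed

end
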